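(* Let $n\ge 1$ be an integer and let $R=\mathbb{F}_1\times\cdots\times\mathbb{F}_t$, where $\mathbb{F}_i$ is a finite field for each $i=1,\ldots,t$. Let $\mathbf{a}=\big((a_{11},\ldots,a_{1t}),\ldots,(a_{n1},\ldots,a_{nt})\big)\in R^n$ be a vertex of $TD(R,n)$ (i.e. $\mathbf{a}\ne\mathbf{0}$). For $i=1,\ldots,t$ put $\tau_i=0$ if $(a_{1i},a_{2i},\ldots,a_{ni})=\mathbf{0}$ and $\tau_i=1$ otherwise. Then the degree of $\mathbf{a}$ in $TD(R,n)$ is $$\frac{|R|^n}{\prod_{i=1}^t|\mathbb{F}_i|^{\tau_i}}-1\ \text{ if } ||\mathbf{a}||\ne 0,\qquad \frac{|R|^n}{\prod_{i=1}^t|\mathbb{F}_i|^{\tau_i}}-2\ \text{ if } ||\mathbf{a}||=0.$$ In particular, the minimum degree of $TD(R,n)$ is either $|R|^{n-1}-1$ or $|R|^{n-1}-2$.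
   Context: For a commutative ring $R$ with nonzero identity and an integer $n\ge1$, $TD(R,n)$ is the simple graph with vertex set $R^n\setminus\{(0,\ldots,0)\}$ in which two distinct vertices $\mathbf{x},\mathbf{y}$ are adjacent if and only if $\mathbf{x}\cdot\mathbf{y}=\sum_{i=1}^n x_iy_i=0$ in $R$. For $\mathbf{a}=(a_1,\ldots,a_n)\in R^n$, $||\mathbf{a}||$ denotes $a_1^2+\cdots+a_n^2\in R$. *)

theory Defs
  imports "HOL-Algebra.Algebra" "Graph_Theory.Graph_Theory"
begin

text \<open>
  Vectors in \<open>R\<^sup>n\<close> are extensional functions on the index set \<open>{1..n}\<close>. The product
  \<open>F\<^sub>1 \<times> \<dots> \<times> F\<^sub>t\<close> is the library's \<^const>\<open>RDirProd_list\<close>, whose elements are lists of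
  length \<open>t\<close>, so the factors and the coordinates in them are numbered from \<open>0\<close>.
\<close>

definition vectors :: "('a, 'm) ring_scheme \<Rightarrow> nat \<Rightarrow> (nat \<Rightarrow> 'a) set" where
  "vectors R n = {1..n} \<rightarrow>\<^sub>E carrier R"

definition zero_vector :: "('a, 'm) ring_scheme \<Rightarrow> nat \<Rightarrow> nat \<Rightarrow> 'a" where
  "zero_vector R n = (\<lambda>j\<in>{1..n}. \<zero>\<^bsub>R\<^esub>)"

definition dot_product ::
  "('a, 'm) ring_scheme \<Rightarrow> nat \<Rightarrow> (nat \<Rightarrow> 'a) \<Rightarrow> (nat \<Rightarrow> 'a) \<Rightarrow> 'a" where
  "dot_product R n x y = (\<Oplus>\<^bsub>R\<^esub>j\<in>{1..n}. x j \<otimes>\<^bsub>R\<^esub> y j)"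

definition sq_norm :: "('a, 'm) ring_scheme \<Rightarrow> nat \<Rightarrow> (nat \<Rightarrow> 'a) \<Rightarrow> 'a" where
  "sq_norm R n a = (\<Oplus>\<^bsub>R\<^esub>j\<in>{1..n}. a j [^]\<^bsub>R\<^esub> (2::nat))"

text \<open>
  As usual for the graph library, a simple graph is a loop-free symmetric set of pairs
  (locale \<^locale>\<open>pair_graph\<close>): an edge between \<open>x\<close> and \<open>y\<close> is given by the two arcs
  \<open>(x, y)\<close> and \<open>(y, x)\<close>, so that the degree of a vertex is its \<^const>\<open>out_degree\<close>.
\<close>

definition TD :: "('a, 'm) ring_scheme \<Rightarrow> nat \<Rightarrow> (nat \<Rightarrow> 'a) pair_pre_digraph" where
  "TD R n = (let V = vectors R n - {zero_vector R n} in
     \<lparr> pverts = V,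
       parcs = {(x, y). x \<in> V \<and> y \<in> V \<and> x \<noteq> y \<and> dot_product R n x y = \<zero>\<^bsub>R\<^esub>} \<rparr>)"

lemma TD_pair_graph:
  assumes "cring R" and "finite (carrier R)"
  shows "pair_graph (TD R n)"
proof -
  interpret cring R by fact
  have dot_comm: "dot_product R n x y = dot_product R n y x"
    if "x \<in> vectors R n" "y \<in> vectors R n" for x y
    unfolding dot_product_def
    using that by (intro finsum_cong') (auto simp: vectors_def intro!: m_comm)
  have fin: "finite (vectors R n)"
    unfolding vectors_def using assms(2) by (intro finite_PiE) auto
  have "parcs (TD R n) \<subseteq> pverts (TD R n) \<times> pverts (TD R n)"
    by (auto simp: TD_def Let_def)
  moreover have fin_verts: "finite (pverts (TD R n))"
    using fin by (simp add: TD_def Let_def)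
  ultimately have fin_arcs: "finite (parcs (TD R n))"
    by (meson finite_SigmaI finite_subset)
  show ?thesis
  proof
    show "symmetric (with_proj (TD R n))"
      by (auto simp: symmetric_def sym_def TD_def Let_def dot_comm arcs_ends_def arc_to_ends_def)
  qed (use fin_verts fin_arcs in \<open>auto simp: TD_def Let_def\<close>)
qed

definition vertex_degree :: "'v pair_pre_digraph \<Rightarrow> 'v \<Rightarrow> nat" where
  "vertex_degree G v = out_degree (with_proj G) v"

definition min_degree :: "'v pair_pre_digraph \<Rightarrow> nat" where
  "min_degree G = Min (vertex_degree G ` pverts G)"

definition tau ::
  "('a, 'm) ring_scheme list \<Rightarrow> nat \<Rightarrow> (nat \<Rightarrow> 'a list) \<Rightarrow> nat \<Rightarrow> nat" where
  "tau Fs n a i = (if \<forall>j\<in>{1..n}. a j ! i = \<zero>\<^bsub>Fs ! i\<^esub> then 0 else 1)"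

end

theory Submission
  imports Defs
begin

text \<open>
  The neighbours of \<open>a\<close> are the vectors orthogonal to \<open>a\<close>, except the zero vector and,
  when \<open>||a|| = a \<cdot> a = 0\<close>, the vector \<open>a\<close> itself. So everything rests on counting
  the annihilator of \<open>a\<close>, that is, the kernel of the additive homomorphism
  \<open>x \<mapsto> a \<cdot> x\<close> from \<open>R\<^sup>n\<close> to \<open>R\<close>. Its fibres over the image all have
  the same size, so the kernel has \<open>|R|\<^sup>n / |image|\<close> elements
  (\<open>card_kernel_times_card_image\<close>).

  The image is computed in each factor separately. The \<open>i\<close>-th coordinate of \<open>a \<cdot> x\<close> is
  the dot product over \<open>\<bbbF>\<^sub>i\<close> of the \<open>i\<close>-th coordinates. It vanishes identically if
  \<open>\<tau>\<^sub>i = 0\<close>, and if \<open>\<tau>\<^sub>i = 1\<close> it takes every value, because some \<open>i\<close>-th coordinate of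
  \<open>a\<close> is invertible in \<open>\<bbbF>\<^sub>i\<close>. The factors are independent of each other, hence the
  image has \<open>\<Prod>\<^sub>i |\<bbbF>\<^sub>i|\<^bsup>\<tau>\<^sub>i\<^esup>\<close> elements (\<open>dot_product_image\<close>,
  \<open>card_lists_with_entries_in\<close>).

  This number is at most \<open>|R|\<close>, so every degree is at least \<open>|R|\<^bsup>n-1\<^esup> - 2\<close>. The
  all-ones vector has \<open>\<tau>\<^sub>i = 1\<close> for all \<open>i\<close>, so its degree is at most
  \<open>|R|\<^bsup>n-1\<^esup> - 1\<close>. The minimum degree is an integer between these two consecutive values.
\<close>

section \<open>Fibres of a group homomorphism\<close>

text \<open>The cosets of the kernel are the fibres over the image, so this is Lagrange's theorem
  for the kernel.\<close>

lemma (in group_hom) card_kernel_times_card_image: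
  "card (kernel G H h) * card (h ` carrier G) = order G"
proof -
  let ?I = "H\<lparr>carrier := h ` carrier G\<rparr>"
  have "group ?I"
    using img_is_subgroup H.subgroup_imp_group by blast
  then interpret I: group_hom G ?I h
    by (simp add: group_hom_def group_hom_axioms_def hom_def)
  have "kernel G ?I h = kernel G H h"
    by (simp add: kernel_def)
  then have "bij_betw (\<lambda>C. the_elem (h ` C)) (carrier (G Mod kernel G H h)) (h ` carrier G)"
    using I.FactGroup_inj_on I.FactGroup_onto by (simp add: bij_betw_def)
  then have "card (carrier (G Mod kernel G H h)) = card (h ` carrier G)"
    by (rule bij_betw_same_card)
  then show ?thesis
    using G.lagrange[OF subgroup_kernel] by (simp add: FactGroup_def mult.commute)
qed

section \<open>The product of a list of rings, coordinate by coordinate\<close>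

lemma RDirProd_list_zero_nth:
  "i < length Rs \<Longrightarrow> \<zero>\<^bsub>RDirProd_list Rs\<^esub> ! i = \<zero>\<^bsub>Rs ! i\<^esub>"
proof (induction Rs arbitrary: i)
  case (Cons R Rs)
  then show ?case by (cases i) (simp_all add: RDirProd_list_zero')
qed simp

lemma RDirProd_list_one_nth:
  "i < length Rs \<Longrightarrow> \<one>\<^bsub>RDirProd_list Rs\<^esub> ! i = \<one>\<^bsub>Rs ! i\<^esub>"
proof (induction Rs arbitrary: i)
  case (Cons R Rs)
  then show ?case by (cases i) (simp_all add: RDirProd_list_one)
qed simp

lemma RDirProd_list_nth_hom:
  assumes "i < length Rs"
  shows "(\<lambda>as. as ! i) \<in> ring_hom (RDirProd_list Rs) (Rs ! i)"
proof -
  have ops: "(as \<otimes>\<^bsub>RDirProd_list Rs\<^esub> bs) ! i = as ! i \<otimes>\<^bsub>Rs ! i\<^esub> bs ! i \<and>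
      (as \<oplus>\<^bsub>RDirProd_list Rs\<^esub> bs) ! i = as ! i \<oplus>\<^bsub>Rs ! i\<^esub> bs ! i"
    if "as \<in> carrier (RDirProd_list Rs)" "bs \<in> carrier (RDirProd_list Rs)" for as bs
    using assms that
  proof (induction Rs arbitrary: i as bs)
    case (Cons R Rs)
    from Cons.prems obtain x xs y ys where as: "as = x # xs" and bs: "bs = y # ys"
      and x: "x \<in> carrier R" and y: "y \<in> carrier R"
      and xs: "xs \<in> carrier (RDirProd_list Rs)" and ys: "ys \<in> carrier (RDirProd_list Rs)"
      by (auto simp: RDirProd_list_carrier)
    let ?P = "RDirProd R (RDirProd_list Rs)"
    have mem: "(x, xs) \<in> carrier ?P" "(y, ys) \<in> carrier ?P"
      using x y xs ys by (auto simp: RDirProd_carrier)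
    have "as \<otimes>\<^bsub>RDirProd_list (R # Rs)\<^esub> bs = (x \<otimes>\<^bsub>R\<^esub> y) # (xs \<otimes>\<^bsub>RDirProd_list Rs\<^esub> ys)"
      using ring_hom_mult[OF RDirProd_list_hom1 mem] unfolding as bs
      by (simp add: RDirProd_def DirProd_def monoid.defs)
    moreover have "as \<oplus>\<^bsub>RDirProd_list (R # Rs)\<^esub> bs = (x \<oplus>\<^bsub>R\<^esub> y) # (xs \<oplus>\<^bsub>RDirProd_list Rs\<^esub> ys)"
      using ring_hom_add[OF RDirProd_list_hom1 mem] unfolding as bs
      by (simp add: RDirProd_def DirProd_def monoid.defs)
    ultimately show ?case
      using Cons.IH[OF _ xs ys] Cons.prems(1) unfolding as bs by (cases i) auto
  qed simp
  show ?thesis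
    using ops assms
    by (intro ring_hom_memI) (auto simp: RDirProd_list_carrier_mem RDirProd_list_one_nth)
qed

lemma RDirProd_list_eqI:
  assumes "as \<in> carrier (RDirProd_list Rs)" "bs \<in> carrier (RDirProd_list Rs)"
    and "\<And>i. i < length Rs \<Longrightarrow> as ! i = bs ! i"
  shows "as = bs"
  using assms by (intro nth_equalityI) (simp_all add: RDirProd_list_carrier_mem(1))

lemma RDirProd_list_cring:
  assumes "\<And>i. i < length Rs \<Longrightarrow> cring (Rs ! i)"
  shows "cring (RDirProd_list Rs)"
proof -
  interpret ring "RDirProd_list Rs"
    using assms by (intro RDirProd_list_is_ring) (simp add: cring.axioms)
  show ?thesis
  proof (unfold_locales, rule RDirProd_list_eqI)
    fix as bs i
    assume "as \<in> carrier (RDirProd_list Rs)" "bs \<in> carrier (RDirProd_list Rs)" "i < length Rs"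
    then show "(as \<otimes>\<^bsub>RDirProd_list Rs\<^esub> bs) ! i = (bs \<otimes>\<^bsub>RDirProd_list Rs\<^esub> as) ! i"
      using cring.cring_simprules(14)[OF assms]
      by (simp add: ring_hom_mult[OF RDirProd_list_nth_hom] RDirProd_list_carrier_mem(2))
  qed auto
qed

lemma card_lists_with_entries_in:
  "card {xs. length xs = m \<and> (\<forall>i<m. xs ! i \<in> A i)} = (\<Prod>i<m. card (A i))"
proof -
  have "bij_betw (\<lambda>f. map f [0..<m]) (Pi\<^sub>E {..<m} A) {xs. length xs = m \<and> (\<forall>i<m. xs ! i \<in> A i)}"
  proof (rule bij_betwI[where g = "\<lambda>xs. \<lambda>i\<in>{..<m}. xs ! i"])
    show "(\<lambda>i\<in>{..<m}. map f [0..<m] ! i) = f" if "f \<in> Pi\<^sub>E {..<m} A" for f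
      using that by (auto simp: PiE_def extensional_def fun_eq_iff)
    show "map (\<lambda>i\<in>{..<m}. xs ! i) [0..<m] = xs"
      if "xs \<in> {xs. length xs = m \<and> (\<forall>i<m. xs ! i \<in> A i)}" for xs
      using that by (simp add: list_eq_iff_nth_eq)
    show "(\<lambda>f. map f [0..<m]) \<in> Pi\<^sub>E {..<m} A \<rightarrow> {xs. length xs = m \<and> (\<forall>i<m. xs ! i \<in> A i)}"
      by (simp add: PiE_iff)
    show "(\<lambda>xs. \<lambda>i\<in>{..<m}. xs ! i) \<in> {xs. length xs = m \<and> (\<forall>i<m. xs ! i \<in> A i)} \<rightarrow> Pi\<^sub>E {..<m} A"
      by (simp add: Pi_iff restrict_PiE_iff)
  qed
  then show ?thesis
    using bij_betw_same_card card_PiE[of "{..<m}" A] by fastforce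
qed

lemma carrier_RDirProd_list_eq:
  "carrier (RDirProd_list Rs) = {xs. length xs = length Rs \<and> (\<forall>i<length Rs. xs ! i \<in> carrier (Rs ! i))}"
  using RDirProd_list_carrier_mem RDirProd_list_carrier_memI by blast

lemma order_RDirProd_list: "order (RDirProd_list Rs) = (\<Prod>i<length Rs. order (Rs ! i))"
  unfolding order_def carrier_RDirProd_list_eq by (rule card_lists_with_entries_in)

lemma (in ring) order_pos: "finite (carrier R) \<Longrightarrow> 0 < order R"
  by (auto simp: order_def card_gt_0_iff)

section \<open>The dot product with a fixed vector\<close>

lemma finite_vectors: "finite (carrier R) \<Longrightarrow> finite (vectors R n)"
  unfolding vectors_def by (intro finite_PiE) auto

lemma vectors_nth: "x \<in> vectors R n \<Longrightarrow> j \<in> {1..n} \<Longrightarrow> x j \<in> carrier R"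
  by (auto simp: vectors_def)

lemma (in cring) sq_norm_eq_dot_product:
  assumes "a \<in> vectors R n"
  shows "sq_norm R n a = dot_product R n a a"
  unfolding sq_norm_def dot_product_def
  using assms by (intro finsum_cong') (auto simp: numeral_2_eq_2 vectors_nth)

lemma (in ring) zero_vector_closed: "zero_vector R n \<in> vectors R n"
  by (simp add: zero_vector_def vectors_def)

lemma (in ring) dot_product_zero_vector:
  assumes "a \<in> vectors R n"
  shows "dot_product R n a (zero_vector R n) = \<zero>"
proof -
  have "dot_product R n a (zero_vector R n) = (\<Oplus>j\<in>{1..n}. \<zero>)"
    unfolding dot_product_def
    using assms by (intro finsum_cong') (auto simp: zero_vector_def vectors_nth)
  then show ?thesis by simp
qed

lemma (in ring) dot_product_group_hom:
  assumes a: "a \<in> vectors R n"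
  shows "group_hom (product_group {1..n} (\<lambda>_. add_monoid R)) (add_monoid R) (dot_product R n a)"
proof -
  have "dot_product R n a (\<lambda>j\<in>{1..n}. x j \<oplus> y j) = dot_product R n a x \<oplus> dot_product R n a y"
    if x: "x \<in> vectors R n" and y: "y \<in> vectors R n" for x y
  proof -
    have "dot_product R n a (\<lambda>j\<in>{1..n}. x j \<oplus> y j) = (\<Oplus>j\<in>{1..n}. a j \<otimes> x j \<oplus> a j \<otimes> y j)"
      unfolding dot_product_def
      using a x y by (intro finsum_cong') (auto simp: vectors_nth r_distr)
    also have "\<dots> = dot_product R n a x \<oplus> dot_product R n a y"
      unfolding dot_product_def using a x y by (intro finsum_addf) (auto simp: vectors_nth)
    finally show ?thesis .
  qed
  moreover have "dot_product R n a x \<in> carrier R" if "x \<in> vectors R n" for x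
    unfolding dot_product_def using a that by (intro finsum_closed) (auto simp: vectors_nth)
  ultimately have "dot_product R n a \<in> hom (product_group {1..n} (\<lambda>_. add_monoid R)) (add_monoid R)"
    by (simp add: hom_def vectors_def)
  then show ?thesis
    by (simp add: group_hom_def group_hom_axioms_def a_group)
qed

lemma (in ring) card_annihilator_times_card_image:
  assumes "a \<in> vectors R n"
  shows "card {x \<in> vectors R n. dot_product R n a x = \<zero>} * card (dot_product R n a ` vectors R n)
    = order R ^ n"
  using group_hom.card_kernel_times_card_image[OF dot_product_group_hom[OF assms]]
  by (simp add: kernel_def order_def vectors_def card_PiE)

lemma dot_product_RDirProd_list_nth:
  assumes rings: "\<And>i. i < length Rs \<Longrightarrow> ring (Rs ! i)"
    and a: "a \<in> vectors (RDirProd_list Rs) n" and x: "x \<in> vectors (RDirProd_list Rs) n"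
    and i: "i < length Rs"
  shows "dot_product (RDirProd_list Rs) n a x ! i = (\<Oplus>\<^bsub>Rs ! i\<^esub>j\<in>{1..n}. a j ! i \<otimes>\<^bsub>Rs ! i\<^esub> x j ! i)"
proof -
  interpret P: ring "RDirProd_list Rs"
    using rings by (rule RDirProd_list_is_ring)
  interpret F: ring "Rs ! i"
    using rings i by blast
  interpret h: ring_hom_ring "RDirProd_list Rs" "Rs ! i" "\<lambda>as. as ! i"
    by (intro ring_hom_ringI2 P.ring_axioms F.ring_axioms RDirProd_list_nth_hom i)
  have "dot_product (RDirProd_list Rs) n a x ! i
      = finsum (Rs ! i) ((\<lambda>as. as ! i) \<circ> (\<lambda>j. a j \<otimes>\<^bsub>RDirProd_list Rs\<^esub> x j)) {1..n}"
    unfolding dot_product_def using a x by (intro h.hom_finsum) (auto simp: vectors_nth)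
  also have "\<dots> = (\<Oplus>\<^bsub>Rs ! i\<^esub>j\<in>{1..n}. a j ! i \<otimes>\<^bsub>Rs ! i\<^esub> x j ! i)"
    using a x by (intro F.finsum_cong') (auto simp: vectors_nth)
  finally show ?thesis .
qed

text \<open>To hit a prescribed value \<open>r\<close>, choose for each factor \<open>i\<close> with \<open>\<tau>\<^sub>i = 1\<close> an index
  \<open>k i\<close> at which \<open>a\<close> has a nonzero \<open>i\<close>-th coordinate, and let \<open>x\<close> have the \<open>i\<close>-th coordinate
  \<open>r\<^sub>i / (a\<^sub>k)\<^sub>i\<close> at this index and zeros elsewhere. The choices for different \<open>i\<close> do not
  interfere, since they concern different coordinates of the entries of \<open>x\<close>.\<close>

lemma dot_product_image:
  assumes fields: "\<And>i. i < length Fs \<Longrightarrow> field (Fs ! i)"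
    and a: "a \<in> vectors (RDirProd_list Fs) n"
  shows "dot_product (RDirProd_list Fs) n a ` vectors (RDirProd_list Fs) n =
    {r. length r = length Fs \<and>
      (\<forall>i<length Fs. r ! i \<in> (if tau Fs n a i = 0 then {\<zero>\<^bsub>Fs ! i\<^esub>} else carrier (Fs ! i)))}"
    (is "?dot ` ?V = ?I")
proof (intro equalityI subsetI)
  have rings: "ring (Fs ! i)" if "i < length Fs" for i
    using fields[OF that] by (simp add: field.is_ring)
  interpret P: ring "RDirProd_list Fs"
    using rings by (rule RDirProd_list_is_ring)
  have a_nth: "a j ! i \<in> carrier (Fs ! i)" if "i < length Fs" "j \<in> {1..n}" for i j
    using a that vectors_nth RDirProd_list_carrier_mem(2) by metis
  have dot_closed: "?dot x \<in> carrier (RDirProd_list Fs)" if "x \<in> ?V" for x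
    unfolding dot_product_def using a that by (intro P.finsum_closed) (auto simp: vectors_nth)
  {
    fix r assume "r \<in> ?dot ` ?V"
    then obtain x where x: "x \<in> ?V" and r: "r = ?dot x" by blast
    have "r ! i = \<zero>\<^bsub>Fs ! i\<^esub>" if i: "i < length Fs" and tau: "tau Fs n a i = 0" for i
    proof -
      interpret F: field "Fs ! i" using fields i .
      have "r ! i = (\<Oplus>\<^bsub>Fs ! i\<^esub>j\<in>{1..n}. a j ! i \<otimes>\<^bsub>Fs ! i\<^esub> x j ! i)"
        unfolding r using rings a x i by (rule dot_product_RDirProd_list_nth)
      also have "\<dots> = (\<Oplus>\<^bsub>Fs ! i\<^esub>j\<in>{1..n}. \<zero>\<^bsub>Fs ! i\<^esub>)"
      proof (rule F.finsum_cong')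
        fix j assume j: "j \<in> {1..n}"
        then have "x j ! i \<in> carrier (Fs ! i)"
          using x i vectors_nth RDirProd_list_carrier_mem(2) by metis
        moreover have "a j ! i = \<zero>\<^bsub>Fs ! i\<^esub>"
          using tau j by (auto simp: tau_def split: if_splits)
        ultimately show "a j ! i \<otimes>\<^bsub>Fs ! i\<^esub> x j ! i = \<zero>\<^bsub>Fs ! i\<^esub>" by simp
      qed auto
      finally show ?thesis by simp
    qed
    then show "r \<in> ?I"
      using dot_closed[OF x] by (auto simp: r RDirProd_list_carrier_mem)
  next
    fix r assume r: "r \<in> ?I"
    have r_nth: "r ! i \<in> carrier (Fs ! i)" if "i < length Fs" for i
      using r that ring.ring_simprules(2)[OF rings[OF that]] by (auto split: if_splits)
    have "\<exists>k. \<forall>i. tau Fs n a i \<noteq> 0 \<longrightarrow> k i \<in> {1..n} \<and> a (k i) ! i \<noteq> \<zero>\<^bsub>Fs ! i\<^esub>"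
      by (intro choice) (auto simp: tau_def)
    then obtain k where k: "tau Fs n a i \<noteq> 0 \<Longrightarrow> k i \<in> {1..n}"
      "tau Fs n a i \<noteq> 0 \<Longrightarrow> a (k i) ! i \<noteq> \<zero>\<^bsub>Fs ! i\<^esub>" for i
      by blast
    define c where "c j i = (if tau Fs n a i \<noteq> 0 \<and> j = k i
      then inv\<^bsub>Fs ! i\<^esub> (a (k i) ! i) \<otimes>\<^bsub>Fs ! i\<^esub> r ! i else \<zero>\<^bsub>Fs ! i\<^esub>)" for j i
    define x where "x = (\<lambda>j\<in>{1..n}. map (c j) [0..<length Fs])"
    have c: "c j i \<in> carrier (Fs ! i)" if i: "i < length Fs" for i j
    proof -
      interpret F: field "Fs ! i" using fields i .
      show ?thesis
        using k[of i] a_nth[OF i, of "k i"] r_nth[OF i] by (auto simp: c_def F.field_Units)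
    qed
    have x: "x \<in> ?V"
      using c by (auto simp: x_def vectors_def intro!: RDirProd_list_carrier_memI)
    have "?dot x = r"
    proof (rule RDirProd_list_eqI)
      show "r \<in> carrier (RDirProd_list Fs)"
        using r r_nth by (intro RDirProd_list_carrier_memI) auto
    next
      fix i assume i: "i < length Fs"
      interpret F: field "Fs ! i" using fields i .
      have "?dot x ! i = (\<Oplus>\<^bsub>Fs ! i\<^esub>j\<in>{1..n}. a j ! i \<otimes>\<^bsub>Fs ! i\<^esub> x j ! i)"
        using rings a x i by (rule dot_product_RDirProd_list_nth)
      also have "\<dots> = (\<Oplus>\<^bsub>Fs ! i\<^esub>j\<in>{1..n}. if k i = j \<and> tau Fs n a i \<noteq> 0 then r ! i else \<zero>\<^bsub>Fs ! i\<^esub>)"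
      proof (rule F.finsum_cong')
        fix j assume j: "j \<in> {1..n}"
        have "a j ! i \<otimes>\<^bsub>Fs ! i\<^esub> (inv\<^bsub>Fs ! i\<^esub> (a j ! i) \<otimes>\<^bsub>Fs ! i\<^esub> r ! i) = r ! i"
          if "a j ! i \<noteq> \<zero>\<^bsub>Fs ! i\<^esub>"
          using that a_nth[OF i j] r_nth[OF i] by (simp add: F.field_Units flip: F.m_assoc)
        then show "a j ! i \<otimes>\<^bsub>Fs ! i\<^esub> x j ! i
            = (if k i = j \<and> tau Fs n a i \<noteq> 0 then r ! i else \<zero>\<^bsub>Fs ! i\<^esub>)"
          using i j k(2)[of i] a_nth[OF i j] by (auto simp: x_def c_def)
      qed (use r_nth[OF i] in auto)
      also have "\<dots> = r ! i"
      proof (cases "tau Fs n a i = 0")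
        case True
        then show ?thesis using r i by auto
      next
        case False
        then show ?thesis
          using F.finsum_singleton[of "k i" "{1..n}" "\<lambda>_. r ! i"] k(1)[OF False] r_nth[OF i] by simp
      qed
      finally show "?dot x ! i = r ! i" .
    qed (rule dot_closed[OF x])
    then show "r \<in> ?dot ` ?V" using x by blast
  }
qed

lemma card_dot_product_image:
  assumes "\<And>i. i < length Fs \<Longrightarrow> field (Fs ! i)" and "a \<in> vectors (RDirProd_list Fs) n"
  shows "card (dot_product (RDirProd_list Fs) n a ` vectors (RDirProd_list Fs) n)
    = (\<Prod>i<length Fs. order (Fs ! i) ^ tau Fs n a i)"
proof -
  note dot_product_image[of Fs a n, OF assms(1) assms(2)]
  then show ?thesis
    by (simp only: card_lists_with_entries_in) (auto simp: tau_def order_def intro!: prod.cong)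
qed

section \<open>Degrees\<close>

lemma vertex_degree_TD:
  assumes "a \<in> pverts (TD R n)"
  shows "vertex_degree (TD R n) a
    = card ({x \<in> vectors R n. dot_product R n a x = \<zero>\<^bsub>R\<^esub>} - {zero_vector R n, a})"
proof -
  have "out_arcs (with_proj (TD R n)) a
      = Pair a ` ({x \<in> vectors R n. dot_product R n a x = \<zero>\<^bsub>R\<^esub>} - {zero_vector R n, a})"
    using assms by (auto simp: out_arcs_def TD_def Let_def)
  then show ?thesis
    by (simp add: vertex_degree_def out_degree_def card_image inj_on_def)
qed

text \<open>The excluded vectors are the members of the annihilator that are not neighbours of \<open>a\<close>:
  always the zero vector, and also \<open>a\<close>, which is different from it, when
  \<open>a\<close> is orthogonal to itself. Adding their number on the left keeps the equation in the naturals
  free of truncated subtraction.\<close>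

lemma degree_plus_excluded_eq_card_annihilator:
  assumes "cring R" and "finite (carrier R)" and a: "a \<in> pverts (TD R n)"
  shows "vertex_degree (TD R n) a + (if sq_norm R n a = \<zero>\<^bsub>R\<^esub> then 2 else 1)
    = card {x \<in> vectors R n. dot_product R n a x = \<zero>\<^bsub>R\<^esub>}" (is "_ = card ?A")
proof -
  interpret cring R by fact
  from a have av: "a \<in> vectors R n" and nz: "a \<noteq> zero_vector R n"
    by (auto simp: TD_def Let_def)
  have fin: "finite ?A"
    using finite_vectors[OF assms(2)] by simp
  have zero: "zero_vector R n \<in> ?A"
    using av by (simp add: zero_vector_closed dot_product_zero_vector)
  have "a \<in> ?A \<longleftrightarrow> sq_norm R n a = \<zero>\<^bsub>R\<^esub>"
    using av by (simp add: sq_norm_eq_dot_product)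
  then have "?A \<inter> {zero_vector R n, a} = (if sq_norm R n a = \<zero>\<^bsub>R\<^esub> then {zero_vector R n, a} else {zero_vector R n})"
    using zero by auto
  then have "card (?A \<inter> {zero_vector R n, a}) = (if sq_norm R n a = \<zero>\<^bsub>R\<^esub> then 2 else 1)"
    using nz by auto
  then show ?thesis
    using card_Diff_subset_Int[of ?A "{zero_vector R n, a}"] card_mono[OF fin, of "?A \<inter> {zero_vector R n, a}"]
    by (simp add: vertex_degree_TD[OF a])
qed

lemma degree_plus_excluded_eq_quotient:
  assumes fields: "\<And>i. i < length Fs \<Longrightarrow> field (Fs ! i)"
    and finite: "\<And>i. i < length Fs \<Longrightarrow> finite (carrier (Fs ! i))"
    and a: "a \<in> pverts (TD (RDirProd_list Fs) n)"
  shows "real (vertex_degree (TD (RDirProd_list Fs) n) a)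
      + (if sq_norm (RDirProd_list Fs) n a = \<zero>\<^bsub>RDirProd_list Fs\<^esub> then 2 else 1)
    = real (order (RDirProd_list Fs)) ^ n / (\<Prod>i<length Fs. real (order (Fs ! i)) ^ tau Fs n a i)"
proof -
  let ?R = "RDirProd_list Fs"
  interpret R: cring ?R
    using fields by (intro RDirProd_list_cring) (simp add: fieldE(1))
  have pos: "0 < order (Fs ! i)" if "i < length Fs" for i
    using fields[OF that] finite[OF that] by (intro ring.order_pos) (simp add: field.is_ring)
  then have "0 < order ?R"
    by (auto simp: order_RDirProd_list intro!: prod_pos)
  then have fin: "finite (carrier ?R)"
    by (simp add: order_def card_gt_0_iff)
  have av: "a \<in> vectors ?R n"
    using a by (simp add: TD_def Let_def)
  have "real (card {x \<in> vectors ?R n. dot_product ?R n a x = \<zero>\<^bsub>?R\<^esub>})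
      * (\<Prod>i<length Fs. real (order (Fs ! i)) ^ tau Fs n a i) = real (order ?R) ^ n"
    using R.card_annihilator_times_card_image[OF av] card_dot_product_image[OF fields av]
    by (simp flip: of_nat_mult of_nat_power of_nat_prod)
  moreover have "(\<Prod>i<length Fs. real (order (Fs ! i)) ^ tau Fs n a i) \<noteq> 0"
    using pos by (intro less_imp_neq[THEN not_sym] prod_pos) auto
  ultimately have "real (card {x \<in> vectors ?R n. dot_product ?R n a x = \<zero>\<^bsub>?R\<^esub>})
    = real (order ?R) ^ n / (\<Prod>i<length Fs. real (order (Fs ! i)) ^ tau Fs n a i)"
    by (rule eq_divide_imp[rotated])
  then show ?thesis
    using degree_plus_excluded_eq_card_annihilator[OF R.is_cring fin a]
    by (auto split: if_splits)
qed

theorem theorem2p7: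
  fixes n :: nat
    and Fs :: "('a, 'm) ring_scheme list"
    and R :: "'a list ring"
  assumes n: "n \<ge> 1"
    and t: "length Fs \<ge> 1"
    and fields: "\<And>i. i < length Fs \<Longrightarrow> field (Fs ! i)"
    and finite: "\<And>i. i < length Fs \<Longrightarrow> finite (carrier (Fs ! i))"
    and R: "R = RDirProd_list Fs"
  shows "(\<forall>a \<in> pverts (TD R n).
            (sq_norm R n a \<noteq> \<zero>\<^bsub>R\<^esub> \<longrightarrow>
               real (vertex_degree (TD R n) a) =
                 real (order R) ^ n / (\<Prod>i<length Fs. real (order (Fs ! i)) ^ tau Fs n a i) - 1) \<and>
            (sq_norm R n a = \<zero>\<^bsub>R\<^esub> \<longrightarrow>
               real (vertex_degree (TD R n) a) =
                 real (order R) ^ n / (\<Prod>i<length Fs. real (order (Fs ! i)) ^ tau Fs n a i) - 2)) \<and>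
         (real (min_degree (TD R n)) = real (order R) ^ (n - 1) - 1 \<or>
          real (min_degree (TD R n)) = real (order R) ^ (n - 1) - 2)"
proof -
  let ?V = "pverts (TD R n)"
  let ?deg = "vertex_degree (TD R n)"
  let ?e = "\<lambda>a. if sq_norm R n a = \<zero>\<^bsub>R\<^esub> then 2 else 1 :: real"
  let ?p = "\<lambda>a. \<Prod>i<length Fs. real (order (Fs ! i)) ^ tau Fs n a i"
  have degree: "real (?deg a) + ?e a = real (order R) ^ n / ?p a" if "a \<in> ?V" for a
    using degree_plus_excluded_eq_quotient[OF fields finite] that unfolding R by blast
  interpret R: cring R
    unfolding R using fields by (intro RDirProd_list_cring) (simp add: fieldE(1))
  have pos: "0 < order (Fs ! i)" if "i < length Fs" for i
    using fields[OF that] finite[OF that] by (intro ring.order_pos) (simp add: field.is_ring)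
  have order: "real (order R) = (\<Prod>i<length Fs. real (order (Fs ! i)))"
    by (simp add: R order_RDirProd_list)
  then have order_pos: "0 < real (order R)"
    using pos by (auto intro!: prod_pos)
  then have "finite (vectors R n)"
    by (intro finite_vectors) (simp add: order_def card_gt_0_iff)
  then have fin: "finite ?V"
    by (simp add: TD_def Let_def)
  have quotient: "real (order R) ^ n / real (order R) = real (order R) ^ (n - 1)"
    using order_pos n by (simp add: power_diff)
  have lower: "real (order R) ^ (n - 1) - 2 \<le> real (?deg a)" if a: "a \<in> ?V" for a
  proof -
    have "?p a \<le> real (order R)"
      unfolding order using pos by (intro prod_mono) (auto simp: tau_def Suc_leI)
    moreover have "0 < ?p a"
      using pos by (intro prod_pos) auto
    ultimately have "real (order R) ^ (n - 1) \<le> real (order R) ^ n / ?p a"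
      unfolding quotient[symmetric] by (intro divide_left_mono) auto
    then show ?thesis
      using degree[OF a] by (auto split: if_splits)
  qed
  \<comment> \<open>The all-ones vector is nonzero in every factor, so its annihilator is as small as possible.\<close>
  define u where "u = (\<lambda>j\<in>{1..n}. \<one>\<^bsub>R\<^esub>)"
  have tau_u: "tau Fs n u i = 1" if i: "i < length Fs" for i
    using n i field.is_ring[OF fields[OF i]] domain.one_not_zero[OF field.axioms(1)[OF fields[OF i]]]
    by (auto simp: tau_def u_def R RDirProd_list_one_nth)
  have "tau Fs n (zero_vector R n) i = 0" if "i < length Fs" for i
    using that by (simp add: tau_def zero_vector_def R RDirProd_list_zero_nth)
  then have "u \<noteq> zero_vector R n"
    using tau_u[of 0] t by force
  then have u: "u \<in> ?V"
    by (simp add: TD_def Let_def vectors_def u_def)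
  have "?p u = real (order R)"
    unfolding order by (intro prod.cong) (auto simp: tau_u)
  then have upper: "real (?deg u) \<le> real (order R) ^ (n - 1) - 1"
    using degree[OF u] quotient by (auto split: if_splits)
  have min_in: "min_degree (TD R n) \<in> ?deg ` ?V"
    unfolding min_degree_def using fin u by (intro Min_in) auto
  then have "real (order R) ^ (n - 1) - 2 \<le> real (min_degree (TD R n))"
    using lower by auto
  moreover have "min_degree (TD R n) \<le> ?deg u"
    unfolding min_degree_def using fin u by (intro Min_le) auto
  \<comment> \<open>The two bounds are consecutive integers, which leaves only these values.\<close>
  ultimately have "min_degree (TD R n) + 1 = order R ^ (n - 1) \<or>
      min_degree (TD R n) + 2 = order R ^ (n - 1)"
    using upper unfolding of_nat_power[symmetric] by linarith
  then have "real (min_degree (TD R n)) = real (order R) ^ (n - 1) - 1 \<or>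
      real (min_degree (TD R n)) = real (order R) ^ (n - 1) - 2"
    unfolding of_nat_power[symmetric] by linarith
  moreover have "(sq_norm R n a \<noteq> \<zero>\<^bsub>R\<^esub> \<longrightarrow> real (?deg a) = real (order R) ^ n / ?p a - 1) \<and>
      (sq_norm R n a = \<zero>\<^bsub>R\<^esub> \<longrightarrow> real (?deg a) = real (order R) ^ n / ?p a - 2)" if "a \<in> ?V" for a
    using degree[OF that] by (auto split: if_splits)
  ultimately show ?thesis by blast
qed

end
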